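(* Let $\mathbf{A}$ be a distributive nearlattice. Then $\mathbf{A}$ is Stone if and only if every $\alpha$-filter of $A$ is a $\sigma$-filter.
   Context: A distributive nearlattice is a join-semilattice $\langle A,\vee,1\rangle$ with greatest element $1$ in which every principal filter $[a)=\{x\in A\colon a\le x\}$ is a bounded distributive lattice. A filter of $A$ is a subset containing $1$, upward closed, and closed under those binary meets that exist; for filters $F,G$, $F\veebar G$ is the smallest filter containing $F\cup G$. For $a\in A$, $a^{\top}=\{x\in A\colon x\vee a=1\}$ and $a^{\top\top}=\{y\in A\colon y\vee x=1\text{ for all }x\in a^{\top}\}$. A filter $F$ is an $\alpha$-filter if $a^{\top\top}\subseteq F$ for all $a\in F$. For a filter $F$, $\sigma(F)=\{x\in A\colon x^{\top}\veebar F=A\}$, and $F$ is a $\sigma$-filter if $\sigma(F)=F$. $\mathbf{A}$ is Stone if $a^{\top}\veebar a^{\top\top}=A$ for every $a\in A$. *)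

theory Defs
  imports "HOL-Algebra.Lattice"
begin

locale bounded_distributive_lattice = Lattice.bounded_lattice L for L (structure) +
  assumes inf_sup_distrib:
    "\<lbrakk>x \<in> carrier L; y \<in> carrier L; z \<in> carrier L\<rbrakk>
      \<Longrightarrow> x \<sqinter> (y \<squnion> z) = (x \<sqinter> y) \<squnion> (x \<sqinter> z)"

definition principal_filter :: "('a, 'b) gorder_scheme \<Rightarrow> 'a \<Rightarrow> 'a set"
  where "principal_filter L a = {x \<in> carrier L. a \<sqsubseteq>\<^bsub>L\<^esub> x}"

text \<open>
  A principal filter is regarded as an ordered set with the order inherited from
  \<open>L\<close>, so its meets and joins are the ones computed inside the principal filter.
\<close>

locale distributive_nearlattice =
  Lattice.upper_semilattice L + weak_partial_order_top L for L (structure) +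
  assumes principal_filter_lattice:
    "a \<in> carrier L \<Longrightarrow> bounded_distributive_lattice (L\<lparr>carrier := principal_filter L a\<rparr>)"

text \<open>
  The meet of \<open>x\<close> and \<open>y\<close> need not exist in \<open>L\<close>; the last clause quantifies over
  the greatest lower bound, if there is one.
\<close>

definition nl_filter :: "('a, 'b) gorder_scheme \<Rightarrow> 'a set \<Rightarrow> bool"
  where "nl_filter L F \<longleftrightarrow>
    F \<subseteq> carrier L \<and>
    \<top>\<^bsub>L\<^esub> \<in> F \<and>
    (\<forall>x\<in>F. \<forall>y\<in>carrier L. x \<sqsubseteq>\<^bsub>L\<^esub> y \<longrightarrow> y \<in> F) \<and>
    (\<forall>x\<in>F. \<forall>y\<in>F. \<forall>m. greatest L m (Lower L {x, y}) \<longrightarrow> m \<in> F)"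

definition filter_join :: "('a, 'b) gorder_scheme \<Rightarrow> 'a set \<Rightarrow> 'a set \<Rightarrow> 'a set"
  where "filter_join L F G = \<Inter> {H. nl_filter L H \<and> F \<union> G \<subseteq> H}"

definition annihilator :: "('a, 'b) gorder_scheme \<Rightarrow> 'a \<Rightarrow> 'a set"
  where "annihilator L a = {x \<in> carrier L. x \<squnion>\<^bsub>L\<^esub> a = \<top>\<^bsub>L\<^esub>}"

definition double_annihilator :: "('a, 'b) gorder_scheme \<Rightarrow> 'a \<Rightarrow> 'a set"
  where "double_annihilator L a =
    {y \<in> carrier L. \<forall>x\<in>annihilator L a. y \<squnion>\<^bsub>L\<^esub> x = \<top>\<^bsub>L\<^esub>}"

definition alpha_filter :: "('a, 'b) gorder_scheme \<Rightarrow> 'a set \<Rightarrow> bool"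
  where "alpha_filter L F \<longleftrightarrow> nl_filter L F \<and> (\<forall>a\<in>F. double_annihilator L a \<subseteq> F)"

definition sigma :: "('a, 'b) gorder_scheme \<Rightarrow> 'a set \<Rightarrow> 'a set"
  where "sigma L F = {x \<in> carrier L. filter_join L (annihilator L x) F = carrier L}"

definition sigma_filter :: "('a, 'b) gorder_scheme \<Rightarrow> 'a set \<Rightarrow> bool"
  where "sigma_filter L F \<longleftrightarrow> nl_filter L F \<and> sigma L F = F"

definition stone :: "('a, 'b) gorder_scheme \<Rightarrow> bool"
  where "stone L \<longleftrightarrow>
    (\<forall>a\<in>carrier L. filter_join L (annihilator L a) (double_annihilator L a) = carrier L)"

lemma (in distributive_nearlattice) nl_filter_carrier: "nl_filter L (carrier L)"
  unfolding nl_filter_def by (auto simp: greatest_def Lower_def)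

lemma (in distributive_nearlattice) nl_filter_filter_join:
  assumes "F \<subseteq> carrier L" "G \<subseteq> carrier L"
  shows "nl_filter L (filter_join L F G)"
proof -
  have "filter_join L F G \<subseteq> carrier L"
    using nl_filter_carrier assms unfolding filter_join_def by blast
  then show ?thesis
    unfolding nl_filter_def filter_join_def by blast
qed

lemma filter_join_upper: "F \<union> G \<subseteq> filter_join L F G"
  unfolding filter_join_def by blast

lemma filter_join_least: "\<lbrakk>nl_filter L H; F \<union> G \<subseteq> H\<rbrakk> \<Longrightarrow> filter_join L F G \<subseteq> H"
  unfolding filter_join_def by blast

end

theory Submission
  imports Defs
begin

text \<open>
  Distributivity makes \<open>\<lambda>y. y \<squnion> x\<close> preserve existing meets, so
  \<open>{y. y \<squnion> x \<in> F}\<close> is a filter for every filter \<open>F\<close>. It contains \<open>F\<close> and the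
  annihilator of \<open>x\<close>; if these generate the whole carrier, it contains \<open>x\<close>, that is,
  \<open>x = x \<squnion> x \<in> F\<close>. Hence \<open>\<sigma>(F) \<subseteq> F\<close> for every filter \<open>F\<close>. For an \<open>\<alpha>\<close>-filter of a
  Stone nearlattice the converse inclusion is immediate. Conversely, every double
  annihilator \<open>a\<^sup>\<top>\<^sup>\<top>\<close> is an \<open>\<alpha>\<close>-filter containing \<open>a\<close>, and \<open>a \<in> \<sigma>(a\<^sup>\<top>\<^sup>\<top>)\<close> is the Stone
  identity at \<open>a\<close>.
\<close>

section \<open>Distributivity and existing meets\<close>

text \<open>Distributing twice splits \<open>(y \<squnion> x) \<sqinter> (z \<squnion> x)\<close>,
  an upper bound of \<open>w\<close>, into pieces that are all below \<open>x\<close>. The law is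
  phrased with inequalities so that, when it is applied in a principal filter, the joins there need
  only be bounded, not computed.\<close>

lemma (in bounded_distributive_lattice) le_of_le_joins:
  assumes carr: "w \<in> carrier L" "x \<in> carrier L" "y \<in> carrier L" "z \<in> carrier L"
    and meet: "y \<sqinter> z \<sqsubseteq> x"
    and le: "w \<sqsubseteq> y \<squnion> x" "w \<sqsubseteq> z \<squnion> x"
  shows "w \<sqsubseteq> x"
proof -
  have *: "z \<sqinter> (y \<squnion> x) = (z \<sqinter> y) \<squnion> (z \<sqinter> x)"
    using carr by (intro inf_sup_distrib)
  have "(z \<sqinter> y) \<squnion> (z \<sqinter> x) \<sqsubseteq> x"
    using carr meet by (intro join_le) (auto simp: meet_right meet_comm[of L z y])
  then have 1: "(y \<squnion> x) \<sqinter> z \<sqsubseteq> x"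
    using * meet_comm[of L z] by metis
  have "w \<sqsubseteq> (y \<squnion> x) \<sqinter> (z \<squnion> x)"
    using carr le by (intro meet_le) auto
  also have "\<dots> = ((y \<squnion> x) \<sqinter> z) \<squnion> ((y \<squnion> x) \<sqinter> x)"
    using carr by (intro inf_sup_distrib) auto
  also have "\<dots> \<sqsubseteq> x"
    using carr 1 by (intro join_le) (auto simp: meet_right)
  finally show ?thesis
    using carr by simp
qed

context distributive_nearlattice
begin

text \<open>Distributivity is available only inside principal filters. The one generated by
  \<open>m\<close> contains \<open>y\<close>, \<open>z\<close> and \<open>m \<squnion> x\<close>, so
  the argument is carried out there.\<close>

lemma greatest_Lower_join:
  assumes m: "greatest L m (Lower L {y, z})"
    and carr: "x \<in> carrier L" "y \<in> carrier L" "z \<in> carrier L"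
  shows "greatest L (m \<squnion> x) (Lower L {y \<squnion> x, z \<squnion> x})"
proof -
  have mc: "m \<in> carrier L"
    using m by simp
  have my: "m \<sqsubseteq> y" and mz: "m \<sqsubseteq> z"
    using m carr by (auto intro: greatest_Lower_below)
  define M where "M = L\<lparr>carrier := principal_filter L m\<rparr>"
  interpret M: bounded_distributive_lattice M
    unfolding M_def by (rule principal_filter_lattice[OF mc])
  have M_carrier: "u \<in> carrier M \<longleftrightarrow> u \<in> carrier L \<and> m \<sqsubseteq> u" for u
    by (simp add: M_def principal_filter_def)
  have M_le: "u \<sqsubseteq>\<^bsub>M\<^esub> v \<longleftrightarrow> u \<sqsubseteq> v" for u v
    by (simp add: M_def)
  have mx: "m \<squnion> x \<in> carrier M" and yM: "y \<in> carrier M" and zM: "z \<in> carrier M"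
    using mc carr my mz by (auto simp: M_carrier join_left)
  \<comment> \<open>Since \<open>x\<close> may lie outside \<open>M\<close>,
    \<open>m \<squnion> x\<close> replaces it. The join of \<open>M\<close> is an upper bound in
    \<open>L\<close> as well, hence above the join of \<open>L\<close>.\<close>
  have join_M: "v \<squnion> x \<sqsubseteq> v \<squnion>\<^bsub>M\<^esub> (m \<squnion> x)" if v: "v \<in> carrier M" for v
  proof -
    have c: "v \<squnion>\<^bsub>M\<^esub> (m \<squnion> x) \<in> carrier L"
      using M.join_closed[OF v mx] M_carrier by blast
    have "m \<squnion> x \<sqsubseteq> v \<squnion>\<^bsub>M\<^esub> (m \<squnion> x)"
      using M.join_right[OF v mx] M_le by blast
    then have "x \<sqsubseteq> v \<squnion>\<^bsub>M\<^esub> (m \<squnion> x)"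
      using le_trans[OF join_right[OF mc carr(1)]] carr mc c by simp
    moreover have "v \<sqsubseteq> v \<squnion>\<^bsub>M\<^esub> (m \<squnion> x)"
      using M.join_left[OF v mx] M_le by blast
    ultimately show ?thesis
      using v c carr M_carrier by (intro join_le) auto
  qed
  \<comment> \<open>The meet taken in \<open>M\<close> is a lower bound of \<open>y\<close> and
    \<open>z\<close> in \<open>L\<close>, hence below \<open>m\<close>.\<close>
  have meet_M: "y \<sqinter>\<^bsub>M\<^esub> z \<sqsubseteq>\<^bsub>M\<^esub> m \<squnion> x"
  proof -
    have c: "y \<sqinter>\<^bsub>M\<^esub> z \<in> carrier L"
      using M.meet_closed[OF yM zM] M_carrier by blast
    then have "y \<sqinter>\<^bsub>M\<^esub> z \<in> Lower L {y, z}"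
      using M.meet_left[OF yM zM] M.meet_right[OF yM zM] M_le
      by (intro Lower_memI) auto
    then have "y \<sqinter>\<^bsub>M\<^esub> z \<sqsubseteq> m"
      using m by (rule greatest_le[rotated])
    then show ?thesis
      using le_trans[OF _ join_left[OF mc carr(1)]] c mc carr M_le by simp
  qed
  show ?thesis
  proof (rule greatest_LowerI)
    fix u assume "u \<in> {y \<squnion> x, z \<squnion> x}"
    then obtain v where v: "v \<in> carrier L" "m \<sqsubseteq> v" and u: "u = v \<squnion> x"
      using carr my mz by blast
    have "m \<sqsubseteq> v \<squnion> x"
      using le_trans[OF v(2) join_left] v mc carr by simp
    then show "m \<squnion> x \<sqsubseteq> u"
      unfolding u using v mc carr by (intro join_le) (auto simp: join_right)
  next
    fix w assume w: "w \<in> Lower L {y \<squnion> x, z \<squnion> x}"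
    then have wc: "w \<in> carrier L" and wy: "w \<sqsubseteq> y \<squnion> x" and wz: "w \<sqsubseteq> z \<squnion> x"
      using carr Lower_memD[OF w] by auto
    \<comment> \<open>The lower bound \<open>w\<close> need not be above \<open>m\<close>; joining
      it with \<open>m\<close> moves it into \<open>M\<close> and only makes the claim
      stronger.\<close>
    have wm: "w \<squnion> m \<in> carrier M"
      using wc mc by (simp add: M_carrier join_right)
    have le_M: "w \<squnion> m \<sqsubseteq>\<^bsub>M\<^esub> v \<squnion>\<^bsub>M\<^esub> (m \<squnion> x)"
      if v: "v \<in> carrier M" and wv: "w \<sqsubseteq> v \<squnion> x" for v
    proof -
      have vM: "v \<squnion>\<^bsub>M\<^esub> (m \<squnion> x) \<in> carrier M"
        by (rule M.join_closed[OF v mx])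
      then have c: "v \<squnion>\<^bsub>M\<^esub> (m \<squnion> x) \<in> carrier L" and mle: "m \<sqsubseteq> v \<squnion>\<^bsub>M\<^esub> (m \<squnion> x)"
        using M_carrier by auto
      have "w \<sqsubseteq> v \<squnion>\<^bsub>M\<^esub> (m \<squnion> x)"
        using le_trans[OF wv join_M[OF v]] wc v carr c M_carrier by simp
      then show ?thesis
        unfolding M_le using wc mc c mle by (intro join_le)
    qed
    have "w \<squnion> m \<sqsubseteq>\<^bsub>M\<^esub> m \<squnion> x"
      using M.le_of_le_joins[OF wm mx yM zM meet_M] le_M yM zM wy wz by blast
    then show "w \<sqsubseteq> m \<squnion> x"
      using le_trans[OF join_left[OF wc mc]] wc mc carr M_le by simp
  qed (use mc carr in auto)
qed

section \<open>Filters, their preimages under joins, and \<open>sigma\<close>\<close>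

lemma top_join: "x \<in> carrier L \<Longrightarrow> \<top> \<squnion> x = \<top>"
  by (intro le_antisym) (auto simp: join_left)

lemma join_idem: "x \<in> carrier L \<Longrightarrow> x \<squnion> x = x"
  by (intro le_antisym join_le join_left) auto

lemma nl_filter_subset: "nl_filter L F \<Longrightarrow> F \<subseteq> carrier L"
  unfolding nl_filter_def by blast

lemma top_in_nl_filter: "nl_filter L F \<Longrightarrow> \<top> \<in> F"
  unfolding nl_filter_def by blast

lemma nl_filter_upclosed: "\<lbrakk>nl_filter L F; x \<in> F; y \<in> carrier L; x \<sqsubseteq> y\<rbrakk> \<Longrightarrow> y \<in> F"
  unfolding nl_filter_def by blast

lemma nl_filter_meet:
  "\<lbrakk>nl_filter L F; x \<in> F; y \<in> F; greatest L m (Lower L {x, y})\<rbrakk> \<Longrightarrow> m \<in> F"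
  unfolding nl_filter_def by blast

lemma nl_filter_top: "nl_filter L {\<top>}"
  unfolding nl_filter_def
proof (intro conjI ballI allI impI)
  fix x y m assume "x \<in> {\<top>}" "y \<in> {\<top>}" and m: "greatest L m (Lower L {x, y})"
  then have "\<top> \<in> Lower L {x, y}"
    by (intro Lower_memI) auto
  then have "\<top> \<sqsubseteq> m"
    using m by (rule greatest_le[rotated])
  then show "m \<in> {\<top>}"
    using m by auto
qed auto

lemma nl_filter_join_preimage:
  assumes F: "nl_filter L F" and x: "x \<in> carrier L"
  shows "nl_filter L {y \<in> carrier L. y \<squnion> x \<in> F}"
  unfolding nl_filter_def
proof (intro conjI ballI allI impI)
  show "\<top> \<in> {y \<in> carrier L. y \<squnion> x \<in> F}"
    using F x by (simp add: top_join top_in_nl_filter)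
next
  fix y z assume y: "y \<in> {y \<in> carrier L. y \<squnion> x \<in> F}" and z: "z \<in> carrier L" and "y \<sqsubseteq> z"
  then have "y \<sqsubseteq> z \<squnion> x"
    using le_trans[OF _ join_left[OF z x]] x by simp
  then have "y \<squnion> x \<sqsubseteq> z \<squnion> x"
    using x y z by (intro join_le) (auto simp: join_right)
  then show "z \<in> {y \<in> carrier L. y \<squnion> x \<in> F}"
    using nl_filter_upclosed[OF F _ join_closed[OF z x]] y z by blast
next
  fix y z m
  assume yz: "y \<in> {y \<in> carrier L. y \<squnion> x \<in> F}" "z \<in> {y \<in> carrier L. y \<squnion> x \<in> F}"
    and m: "greatest L m (Lower L {y, z})"
  then have mx: "greatest L (m \<squnion> x) (Lower L {y \<squnion> x, z \<squnion> x})"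
    using x by (intro greatest_Lower_join) auto
  have "m \<squnion> x \<in> F"
    using yz by (intro nl_filter_meet[OF F _ _ mx]) simp_all
  then show "m \<in> {y \<in> carrier L. y \<squnion> x \<in> F}"
    using m by simp
qed blast

lemma sigma_subset:
  assumes F: "nl_filter L F"
  shows "sigma L F \<subseteq> F"
proof
  fix x assume "x \<in> sigma L F"
  then have x: "x \<in> carrier L" and gen: "filter_join L (annihilator L x) F = carrier L"
    by (auto simp: sigma_def)
  let ?H = "{y \<in> carrier L. y \<squnion> x \<in> F}"
  have "annihilator L x \<subseteq> ?H"
    using top_in_nl_filter[OF F] by (auto simp: annihilator_def)
  moreover have "F \<subseteq> ?H"
  proof
    fix y assume y: "y \<in> F"
    then have "y \<in> carrier L"
      using nl_filter_subset[OF F] by blast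
    then show "y \<in> ?H"
      using nl_filter_upclosed[OF F y] x by (simp add: join_left)
  qed
  ultimately have "filter_join L (annihilator L x) F \<subseteq> ?H"
    by (intro filter_join_least nl_filter_join_preimage F x Un_least)
  then have "x \<in> ?H"
    unfolding gen using x by (rule subsetD)
  then show "x \<in> F"
    using x by (simp add: join_idem)
qed

section \<open>Annihilators and double annihilators as filters\<close>

text \<open>The annihilator is the preimage of the filter \<open>{\<top>}\<close> under joining with
  \<open>a\<close>.\<close>

lemma nl_filter_annihilator:
  assumes "a \<in> carrier L"
  shows "nl_filter L (annihilator L a)"
  using nl_filter_join_preimage[OF nl_filter_top assms] by (simp add: annihilator_def)

text \<open>Intersecting with the carrier keeps the result inside \<open>L\<close> even for an empty
  family, where \<open>\<Inter>\<F>\<close> is the whole type.\<close>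

lemma nl_filter_carrier_Inter:
  assumes "\<And>F. F \<in> \<F> \<Longrightarrow> nl_filter L F"
  shows "nl_filter L (carrier L \<inter> \<Inter>\<F>)"
  unfolding nl_filter_def
proof (intro conjI ballI allI impI)
  show "\<top> \<in> carrier L \<inter> \<Inter>\<F>"
    using assms by (auto intro: top_in_nl_filter)
next
  fix x y assume x: "x \<in> carrier L \<inter> \<Inter>\<F>" and y: "y \<in> carrier L" "x \<sqsubseteq> y"
  have "y \<in> F" if "F \<in> \<F>" for F
    using nl_filter_upclosed[OF assms[OF that]] x y that by auto
  then show "y \<in> carrier L \<inter> \<Inter>\<F>"
    using y by blast
next
  fix x y m assume xy: "x \<in> carrier L \<inter> \<Inter>\<F>" "y \<in> carrier L \<inter> \<Inter>\<F>"
    and m: "greatest L m (Lower L {x, y})"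
  have "m \<in> F" if "F \<in> \<F>" for F
    using nl_filter_meet[OF assms[OF that] _ _ m] xy that by auto
  then show "m \<in> carrier L \<inter> \<Inter>\<F>"
    using m by simp
qed blast

text \<open>In this form the double annihilator is visibly an intersection of filters.\<close>

lemma double_annihilator_eq:
  "double_annihilator L a = carrier L \<inter> \<Inter>(annihilator L ` annihilator L a)"
  by (auto simp: double_annihilator_def annihilator_def)

lemma mem_double_annihilator:
  assumes "a \<in> carrier L"
  shows "a \<in> double_annihilator L a"
proof -
  have "a \<squnion> x = \<top>" if "x \<in> annihilator L a" for x
    using that join_comm[of L a x] by (simp add: annihilator_def)
  then show ?thesis
    using assms by (simp add: double_annihilator_def)
qed

lemma alpha_filter_double_annihilator: "alpha_filter L (double_annihilator L a)"
proof -
  have "nl_filter L (annihilator L x)" if "x \<in> annihilator L a" for x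
    using that by (intro nl_filter_annihilator) (simp add: annihilator_def)
  then have "nl_filter L (double_annihilator L a)"
    unfolding double_annihilator_eq by (intro nl_filter_carrier_Inter) blast
  moreover have "double_annihilator L b \<subseteq> double_annihilator L a"
    if b: "b \<in> double_annihilator L a" for b
  proof -
    \<comment> \<open>Membership of \<open>b\<close> in the double annihilator of \<open>a\<close>
      enlarges the annihilator, and a larger annihilator imposes more conditions on the double
      annihilator.\<close>
    have "x \<in> annihilator L b" if "x \<in> annihilator L a" for x
      using that b join_comm[of L b x] by (simp add: double_annihilator_def annihilator_def)
    then show ?thesis
      unfolding double_annihilator_def by blast
  qed
  ultimately show ?thesis
    by (simp add: alpha_filter_def)
qed

section \<open>The equivalence\<close>

text \<open>The \<alpha>-condition puts the double annihilator of \<open>a\<close> inside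
  \<open>F\<close>. Filter joins are monotone, so the Stone identity at \<open>a\<close> survives
  when \<open>F\<close> replaces that double annihilator.\<close>

lemma stone_imp_alpha_subset_sigma:
  assumes "stone L" and F: "alpha_filter L F"
  shows "F \<subseteq> sigma L F"
proof
  fix a assume a: "a \<in> F"
  have FL: "F \<subseteq> carrier L"
    using F by (intro nl_filter_subset) (simp add: alpha_filter_def)
  then have ac: "a \<in> carrier L" and sub: "double_annihilator L a \<subseteq> F"
    using F a by (auto simp: alpha_filter_def)
  have "annihilator L a \<subseteq> carrier L"
    by (auto simp: annihilator_def)
  then have J: "nl_filter L (filter_join L (annihilator L a) F)"
    using FL by (rule nl_filter_filter_join)
  have "annihilator L a \<union> double_annihilator L a \<subseteq> filter_join L (annihilator L a) F"
    using sub filter_join_upper[of "annihilator L a" F L] by blast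
  then have "filter_join L (annihilator L a) (double_annihilator L a)
      \<subseteq> filter_join L (annihilator L a) F"
    by (rule filter_join_least[OF J])
  then show "a \<in> sigma L F"
    using assms(1) ac nl_filter_subset[OF J] by (auto simp: stone_def sigma_def)
qed

end

theorem theorem4p14:
  fixes L :: "('a, 'b) gorder_scheme"
  assumes "distributive_nearlattice L"
  shows "stone L \<longleftrightarrow> (\<forall>F. alpha_filter L F \<longrightarrow> sigma_filter L F)"
proof -
  interpret distributive_nearlattice L
    by (rule assms)
  show ?thesis
  proof (intro iffI allI impI)
    fix F assume "stone L" and F: "alpha_filter L F"
    then have "F \<subseteq> sigma L F"
      by (rule stone_imp_alpha_subset_sigma)
    moreover have "nl_filter L F"
      using F by (simp add: alpha_filter_def)
    ultimately show "sigma_filter L F"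
      using sigma_subset by (auto simp: sigma_filter_def)
  next
    assume "\<forall>F. alpha_filter L F \<longrightarrow> sigma_filter L F"
    then have "a \<in> sigma L (double_annihilator L a)" if "a \<in> carrier L" for a
      using alpha_filter_double_annihilator mem_double_annihilator[OF that]
      by (simp add: sigma_filter_def)
    then show "stone L"
      by (simp add: stone_def sigma_def)
  qed
qed

end
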